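(* Let $\mathrm{CW}=\bigoplus_{i\in\mathbb{Z}}\mathbb{C}[\partial]L_i$ be the loop Virasoro Lie conformal algebra, with $[{L_i}_\lambda L_j]=(\partial+2\lambda)L_{i+j}$ for all $i,j\in\mathbb{Z}$. For every conformal biderivation $\phi_\lambda$ of $\mathrm{CW}$ there exists a family of complex numbers $\{a_k\}_{k\in\mathbb{Z}}$ such that, for all $i,j\in\mathbb{Z}$, $$\phi_\lambda(L_i,L_j)=(\partial+2\lambda)\sum_{k\in\mathbb{Z}}a_{k-i-j}L_k .$$
   Context: All vector spaces, linear maps and tensor products are over $\mathbb{C}$. A Lie conformal algebra is a $\mathbb{C}[\partial]$-module $R$ with a $\mathbb{C}$-bilinear map $R\times R\to R[\lambda]$, $(x,y)\mapsto[x_\lambda y]$ (the $\lambda$-bracket), such that for all $x,y,z\in R$: (1) $[(\partial x)_\lambda y]=-\lambda[x_\lambda y]$; (2) $[x_\lambda y]=-[y_{-\partial-\lambda}x]$; (3) $[x_\lambda[y_\mu z]]=[[x_\lambda y]_{\lambda+\mu}z]+[y_\mu[x_\lambda z]]$. A conformal bilinear map $\phi_\lambda:R\times R\to R[\lambda]$ is a $\mathbb{C}$-bilinear map with $\phi_\lambda(\partial x,y)=-\lambda\phi_\lambda(x,y)$ and $\phi_\lambda(x,\partial y)=(\partial+\lambda)\phi_\lambda(x,y)$. A conformal biderivation of $R$ is a conformal bilinear map $\phi_\lambda:R\times R\to R[\lambda]$ such that for all $x,y,z\in R$: $\phi_\lambda(x,y)=-\phi_{-\partial-\lambda}(y,x)$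 and $\phi_\lambda(x,[y_\mu z])=[(\phi_\lambda(x,y))_{\lambda+\mu}z]+[y_\mu\phi_\lambda(x,z)]$. Conventions: if $\phi_\lambda(y,x)=\sum_n\lambda^n c_n$ with $c_n\in R$, then $\phi_{-\partial-\lambda}(y,x)=\sum_n(-\partial-\lambda)^n c_n$ (and likewise for the bracket); brackets and $\phi$ are extended linearly over polynomials in the formal variables, e.g. $[(\phi_\lambda(x,y))_{\lambda+\mu}z]=\sum_n\lambda^n[{c_n}_{\lambda+\mu}z]$ if $\phi_\lambda(x,y)=\sum_n\lambda^n c_n$. $\mathrm{CW}$ is the free $\mathbb{C}[\partial]$-module with basis $\{L_i\mid i\in\mathbb{Z}\}$ with the $\lambda$-bracket given in the claim. Since $\phi_\lambda$ takes values in $\mathrm{CW}[\lambda]$ and $\mathrm{CW}$ is an algebraic direct sum, sums over $k\in\mathbb{Z}$ are finite sums (only finitely many $a_k$ are nonzero). *)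

theory Defs
  imports Complex_Main "HOL-Library.Poly_Mapping" "HOL-Computational_Algebra.Polynomial"
begin

text \<open>
  Encoding. The algebra of operators is \<open>complex poly\<close>, whose indeterminate \<open>[:0, 1:]\<close> is
  the derivation; a module over it is given by \<open>scale :: complex poly \<Rightarrow> 'r \<Rightarrow> 'r\<close>.
  \<open>'r poly\<close> is the space of polynomials in \<open>\<lambda>\<close> with coefficients in \<open>'r\<close>, where
  \<open>pCons 0\<close> is multiplication by \<open>\<lambda>\<close>. \<open>'r poly poly\<close> is the space of polynomials in
  \<open>\<lambda>\<close> and \<open>\<mu>\<close>: the outer variable is \<open>\<mu>\<close> (multiplication \<open>pCons 0\<close>), the inner one is
  \<open>\<lambda>\<close> (multiplication \<open>map_poly (pCons 0)\<close>).
\<close>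

text \<open>
  If \<open>p\<close> has coefficients \<open>c n\<close>, then \<open>poly_subst h T p\<close> is the sum of \<open>T ^^ n\<close> applied to
  \<open>h (c n)\<close>: the variable of \<open>p\<close> is replaced by the operator \<open>T\<close>, and each coefficient
  by its image under \<open>h\<close>.
\<close>

definition poly_subst :: "('a::zero \<Rightarrow> 'b::comm_monoid_add) \<Rightarrow> ('b \<Rightarrow> 'b) \<Rightarrow> 'a poly \<Rightarrow> 'b"
  where "poly_subst h T p = (\<Sum>n\<le>degree p. (T ^^ n) (h (coeff p n)))"

text \<open>
  For a map \<open>f :: 'r \<Rightarrow> 'r \<Rightarrow> 'r poly\<close>, written \<open>f\<^sub>\<lambda>(x, y)\<close>, the following are
  \<open>f\<^sub>\<lambda>(x, q(\<mu>))\<close>, \<open>f\<^sub>\<mu>(y, q(\<lambda>))\<close> and \<open>f\<^sub>\<lambda>\<^sub>+\<^sub>\<mu>(q(\<lambda>), z)\<close>,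
  each a polynomial in \<open>\<lambda>\<close> and \<open>\<mu>\<close>.
\<close>

definition nest_lambda_mu ::
    "('r::ab_group_add \<Rightarrow> 'r \<Rightarrow> 'r poly) \<Rightarrow> 'r \<Rightarrow> 'r poly \<Rightarrow> 'r poly poly"
  where "nest_lambda_mu f x = poly_subst (\<lambda>d. [:f x d:]) (pCons 0)"

definition nest_mu_lambda ::
    "('r::ab_group_add \<Rightarrow> 'r \<Rightarrow> 'r poly) \<Rightarrow> 'r \<Rightarrow> 'r poly \<Rightarrow> 'r poly poly"
  where "nest_mu_lambda f y =
    poly_subst (\<lambda>c. map_poly (\<lambda>r. [:r:]) (f y c)) (map_poly (pCons 0))"

definition nest_sum ::
    "('r::ab_group_add \<Rightarrow> 'r \<Rightarrow> 'r poly) \<Rightarrow> 'r poly \<Rightarrow> 'r \<Rightarrow> 'r poly poly"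
  where "nest_sum f q z =
    poly_subst
      (\<lambda>c. poly_subst (\<lambda>r. [:[:r:]:]) (\<lambda>w. map_poly (pCons 0) w + pCons 0 w) (f c z))
      (map_poly (pCons 0)) q"

locale del_module = module scale
  for scale :: "complex poly \<Rightarrow> 'r::ab_group_add \<Rightarrow> 'r"
begin

definition del :: "'r \<Rightarrow> 'r"
  where "del = scale [:0, 1:]"

definition cscale :: "complex \<Rightarrow> 'r \<Rightarrow> 'r"
  where "cscale c = scale [:c:]"

text \<open>Substitution of \<open>-\<partial> - \<lambda>\<close> for the variable:\<close>

definition subst_neg :: "'r poly \<Rightarrow> 'r poly"
  where "subst_neg = poly_subst (\<lambda>c. [:c:]) (\<lambda>q. - map_poly del q - pCons 0 q)"

definition bilinear_lambda :: "('r \<Rightarrow> 'r \<Rightarrow> 'r poly) \<Rightarrow> bool"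
  where "bilinear_lambda f \<longleftrightarrow>
    (\<forall>y. Vector_Spaces.linear cscale (\<lambda>c. map_poly (cscale c)) (\<lambda>x. f x y)) \<and>
    (\<forall>x. Vector_Spaces.linear cscale (\<lambda>c. map_poly (cscale c)) (\<lambda>y. f x y))"

end

locale lie_conformal_algebra = del_module scale
  for scale :: "complex poly \<Rightarrow> 'r::ab_group_add \<Rightarrow> 'r" +
  fixes bracket :: "'r \<Rightarrow> 'r \<Rightarrow> 'r poly"
  assumes bracket_bilinear: "bilinear_lambda bracket"
    and bracket_del_left: "bracket (del x) y = - pCons 0 (bracket x y)"
    and bracket_skew: "bracket x y = - subst_neg (bracket y x)"
    and bracket_jacobi: "nest_lambda_mu bracket x (bracket y z) =
          nest_sum bracket (bracket x y) z + nest_mu_lambda bracket y (bracket x z)"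

locale conformal_bilinear_map = del_module scale
  for scale :: "complex poly \<Rightarrow> 'r::ab_group_add \<Rightarrow> 'r" +
  fixes \<phi> :: "'r \<Rightarrow> 'r \<Rightarrow> 'r poly"
  assumes bilinear: "bilinear_lambda \<phi>"
    and del_left: "\<phi> (del x) y = - pCons 0 (\<phi> x y)"
    and del_right: "\<phi> x (del y) = map_poly del (\<phi> x y) + pCons 0 (\<phi> x y)"

locale conformal_biderivation =
  lie_conformal_algebra scale bracket + conformal_bilinear_map scale \<phi>
  for scale :: "complex poly \<Rightarrow> 'r::ab_group_add \<Rightarrow> 'r"
    and bracket :: "'r \<Rightarrow> 'r \<Rightarrow> 'r poly"
    and \<phi> :: "'r \<Rightarrow> 'r \<Rightarrow> 'r poly" +
  assumes skew: "\<phi> x y = - subst_neg (\<phi> y x)"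
    and derivation: "nest_lambda_mu \<phi> x (bracket y z) =
          nest_sum bracket (\<phi> x y) z + nest_mu_lambda bracket y (\<phi> x z)"

text \<open>
  The underlying module of the loop Virasoro Lie conformal algebra: finitely supported
  functions form the free \<open>complex poly\<close>-module with basis \<open>L i\<close>.
\<close>

type_synonym cw = "int \<Rightarrow>\<^sub>0 complex poly"

definition cw_scale :: "complex poly \<Rightarrow> cw \<Rightarrow> cw"
  where "cw_scale p = Poly_Mapping.map ((*) p)"

definition L :: "int \<Rightarrow> cw"
  where "L i = Poly_Mapping.single i 1"

text \<open>\<open>(\<partial> + 2\<lambda>) v\<close>:\<close>

definition del_plus_2lambda :: "cw \<Rightarrow> cw poly"
  where "del_plus_2lambda v = [: cw_scale [:0, 1:] v, cw_scale 2 v :]"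

text \<open>
  The extension of the bracket of generators that is forced by bilinearity and
  sesquilinearity in both arguments: the bracket of \<open>f(\<partial>) L i\<close> and \<open>g(\<partial>) L j\<close> is
  \<open>f(-\<lambda>) g(\<partial> + \<lambda>) (\<partial> + 2\<lambda>) L (i + j)\<close>. In the scalar factor, of type
  \<open>complex poly poly\<close>, the outer variable is \<open>\<lambda>\<close> and the inner one is \<open>\<partial>\<close>.
\<close>

definition cw_coeff :: "complex poly \<Rightarrow> complex poly \<Rightarrow> complex poly poly"
  where "cw_coeff f g =
    poly (map_poly (\<lambda>c. [:[:c:]:]) f) [:0, - 1:] *
    poly (map_poly (\<lambda>c. [:[:c:]:]) g) [:[:0, 1:], 1:] *
    [:[:0, 1:], 2:]"

definition cw_bracket :: "cw \<Rightarrow> cw \<Rightarrow> cw poly"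
  where "cw_bracket u v =
    (\<Sum>i\<in>Poly_Mapping.keys u. \<Sum>j\<in>Poly_Mapping.keys v.
      map_poly (Poly_Mapping.single (i + j))
        (cw_coeff (Poly_Mapping.lookup u i) (Poly_Mapping.lookup v j)))"

lemma map_poly_add:
  assumes "\<And>x y. h (x + y) = h x + (h y :: 'b::comm_monoid_add)" "h 0 = 0"
  shows "map_poly h (p + q) = map_poly h p + map_poly h q"
  using assms by (intro poly_eqI) (simp add: coeff_map_poly)

lemma (in del_module) vector_space_cscale: "vector_space cscale"
proof unfold_locales
  fix a b :: complex and x y :: 'r
  show "cscale a (x + y) = cscale a x + cscale a y"
    by (simp add: cscale_def scale_right_distrib)
  have "cscale (a + b) x = scale ([:a:] + [:b:]) x" by (simp add: cscale_def)
  then show "cscale (a + b) x = cscale a x + cscale b x"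
    by (simp only: cscale_def scale_left_distrib)
  show "cscale a (cscale b x) = cscale (a * b) x"
    by (simp add: cscale_def mult.commute)
  show "cscale 1 x = x"
    by (simp add: cscale_def flip: one_pCons)
qed

lemma (in del_module) vector_space_map_poly_cscale:
  "vector_space (\<lambda>c. map_poly (cscale c))"
proof -
  interpret V: vector_space cscale by (rule vector_space_cscale)
  show ?thesis
    by unfold_locales
      (auto intro!: poly_eqI simp: coeff_map_poly V.scale_right_distrib V.scale_left_distrib)
qed

lemma lookup_cw_scale [simp]:
  "Poly_Mapping.lookup (cw_scale p u) k = p * Poly_Mapping.lookup u k"
  unfolding cw_scale_def by transfer (simp add: when_def)

global_interpretation cw: del_module cw_scale
  by unfold_locales (auto intro!: poly_mapping_eqI simp: lookup_add algebra_simps)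

lemma lookup_cw_cscale:
  "Poly_Mapping.lookup (cw.cscale c u) k = [:c:] * Poly_Mapping.lookup u k"
  by (simp add: cw.cscale_def)

text \<open>
  Evaluation of the \<open>L k\<close>-component at \<open>\<partial> = t\<close> and \<open>\<lambda> = l\<close>; these evaluations separate
  the elements of \<open>cw poly\<close>.
\<close>

definition cw_ev :: "int \<Rightarrow> complex \<Rightarrow> complex \<Rightarrow> cw poly \<Rightarrow> complex"
  where "cw_ev k t l p = poly (map_poly (\<lambda>r. poly (Poly_Mapping.lookup r k) t) p) l"

definition cw_ev2 :: "int \<Rightarrow> complex \<Rightarrow> complex \<Rightarrow> complex \<Rightarrow> cw poly poly \<Rightarrow> complex"
  where "cw_ev2 k t l m q = poly (map_poly (cw_ev k t l) q) m"

lemma cw_ev_0 [simp]: "cw_ev k t l 0 = 0"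
  by (simp add: cw_ev_def)

lemma cw_ev_add [simp]: "cw_ev k t l (p + q) = cw_ev k t l p + cw_ev k t l q"
  by (simp add: cw_ev_def map_poly_add lookup_add)

lemma cw_ev_uminus [simp]: "cw_ev k t l (- p) = - cw_ev k t l p"
  using cw_ev_add[of k t l p "- p"] by (simp add: add_eq_0_iff)

lemma cw_ev_diff [simp]: "cw_ev k t l (p - q) = cw_ev k t l p - cw_ev k t l q"
  using cw_ev_add[of k t l p "- q"] by simp

lemma cw_ev_sum: "cw_ev k t l (sum f A) = (\<Sum>a\<in>A. cw_ev k t l (f a))"
  by (induction A rule: infinite_finite_induct) auto

lemma cw_ev_pCons [simp]:
  "cw_ev k t l (pCons r p) = poly (Poly_Mapping.lookup r k) t + l * cw_ev k t l p"
  by (simp add: cw_ev_def map_poly_pCons)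

lemma cw_ev_map_poly:
  assumes "h 0 = 0" "\<And>r. poly (Poly_Mapping.lookup (h r) k) t = c * poly (Poly_Mapping.lookup r k') t'"
  shows "cw_ev k t l (map_poly h p) = c * cw_ev k' t' l p"
proof (induction p)
  case (pCons r p)
  then show ?case by (simp add: map_poly_pCons assms algebra_simps)
qed simp

lemma cw_ev_del [simp]: "cw_ev k t l (map_poly cw.del p) = t * cw_ev k t l p"
  by (rule cw_ev_map_poly) (auto simp: cw.del_def)

lemma cw_ev_cscale [simp]: "cw_ev k t l (map_poly (cw.cscale c) p) = c * cw_ev k t l p"
  by (rule cw_ev_map_poly) (auto simp: cw.cscale_def)

lemma cw_ev_single:
  "cw_ev k t l (map_poly (Poly_Mapping.single i) P) = (if i = k then poly (poly P [:l:]) t else 0)"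
  by (induction P) (auto simp: map_poly_pCons lookup_single when_def)

lemma cw_ev_eqI:
  assumes "\<And>k t l. cw_ev k t l p = cw_ev k t l q"
  shows "p = q"
proof (rule poly_eqI, rule poly_mapping_eqI)
  fix n k
  have "poly (Poly_Mapping.lookup (coeff p n) k) t = poly (Poly_Mapping.lookup (coeff q n) k) t" for t
  proof -
    have "poly (map_poly (\<lambda>r. poly (Poly_Mapping.lookup r k) t) p) =
          poly (map_poly (\<lambda>r. poly (Poly_Mapping.lookup r k) t) q)"
      using assms by (intro ext) (simp add: cw_ev_def)
    then have "map_poly (\<lambda>r. poly (Poly_Mapping.lookup r k) t) p =
          map_poly (\<lambda>r. poly (Poly_Mapping.lookup r k) t) q"
      by (simp add: poly_eq_poly_eq_iff)
    then have "coeff (map_poly (\<lambda>r. poly (Poly_Mapping.lookup r k) t) p) n =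
          coeff (map_poly (\<lambda>r. poly (Poly_Mapping.lookup r k) t) q) n"
      by simp
    then show ?thesis by (simp add: coeff_map_poly)
  qed
  then show "Poly_Mapping.lookup (coeff p n) k = Poly_Mapping.lookup (coeff q n) k"
    by (simp add: poly_eq_poly_eq_iff[symmetric] fun_eq_iff)
qed

lemma cw_ev2_0 [simp]: "cw_ev2 k t l m 0 = 0"
  by (simp add: cw_ev2_def)

lemma cw_ev2_add [simp]: "cw_ev2 k t l m (p + q) = cw_ev2 k t l m p + cw_ev2 k t l m q"
  by (simp add: cw_ev2_def map_poly_add)

lemma cw_ev2_pCons [simp]: "cw_ev2 k t l m (pCons r p) = cw_ev k t l r + m * cw_ev2 k t l m p"
  by (simp add: cw_ev2_def map_poly_pCons)

lemma cw_ev2_lambda [simp]: "cw_ev2 k t l m (map_poly (pCons 0) p) = l * cw_ev2 k t l m p"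
  by (induction p) (auto simp: map_poly_pCons algebra_simps)

lemma cw_ev2_embed [simp]: "cw_ev2 k t l m (map_poly (\<lambda>r. [:r:]) p) = cw_ev k t m p"
  by (induction p) (auto simp: map_poly_pCons algebra_simps)

lemma cw_ev2_eqI:
  assumes "\<And>k t l m. cw_ev2 k t l m p = cw_ev2 k t l m q"
  shows "p = q"
proof (rule poly_eqI, rule cw_ev_eqI)
  fix n k t l
  have "poly (map_poly (cw_ev k t l) p) = poly (map_poly (cw_ev k t l) q)"
    using assms by (intro ext) (simp add: cw_ev2_def)
  then have "map_poly (cw_ev k t l) p = map_poly (cw_ev k t l) q"
    by (simp add: poly_eq_poly_eq_iff)
  then have "coeff (map_poly (cw_ev k t l) p) n = coeff (map_poly (cw_ev k t l) q) n"
    by simp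
  then show "cw_ev k t l (coeff p n) = cw_ev k t l (coeff q n)"
    by (simp add: coeff_map_poly)
qed

text \<open>A complex-valued functional turns an operator substitution into an evaluation.\<close>

lemma poly_subst_functional:
  fixes F :: "'b::comm_monoid_add \<Rightarrow> complex"
  assumes add: "\<And>a b. F (a + b) = F a + F b" and zero: "F 0 = 0"
    and T: "\<And>w. F (T w) = \<tau> * F w" and h: "\<And>c. F (h c) = g c" and g0: "g 0 = 0"
  shows "F (poly_subst h T p) = poly (map_poly g p) \<tau>"
proof -
  have pow: "F ((T ^^ n) w) = \<tau> ^ n * F w" for n w
    by (induction n) (auto simp: T)
  have "F (sum f A) = (\<Sum>a\<in>A. F (f a))" for f :: "nat \<Rightarrow> 'b" and A
    by (induction A rule: infinite_finite_induct) (auto simp: add zero)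
  then have "F (poly_subst h T p) = (\<Sum>n\<le>degree p. g (coeff p n) * \<tau> ^ n)"
    by (simp add: poly_subst_def pow h mult.commute)
  also have "\<dots> = poly (map_poly g p) \<tau>"
    unfolding poly_altdef
  proof (rule sum.mono_neutral_cong_right)
    have "degree (map_poly g p) \<le> degree p"
      by (rule degree_le) (simp add: coeff_map_poly coeff_eq_0 g0)
    then show "{..degree (map_poly g p)} \<subseteq> {..degree p}" by auto
    show "\<forall>i\<in>{..degree p} - {..degree (map_poly g p)}. g (coeff p i) * \<tau> ^ i = 0"
      using coeff_eq_0[of "map_poly g p"] by (auto simp: coeff_map_poly g0)
  qed (auto simp: coeff_map_poly g0)
  finally show ?thesis .
qed

lemma cw_ev_subst_neg: "cw_ev k t l (cw.subst_neg p) = cw_ev k t (- t - l) p"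
  unfolding cw.subst_neg_def
  by (subst poly_subst_functional[where \<tau> = "- t - l" and g = "\<lambda>r. poly (Poly_Mapping.lookup r k) t"])
    (auto simp: cw_ev_def[of k t "- t - l"] algebra_simps)

lemma cw_ev2_nest_lambda_mu:
  assumes "f x 0 = 0"
  shows "cw_ev2 k t l m (nest_lambda_mu f x q) = poly (map_poly (\<lambda>d. cw_ev k t l (f x d)) q) m"
  unfolding nest_lambda_mu_def
  by (rule poly_subst_functional) (auto simp: assms)

lemma cw_ev2_nest_mu_lambda:
  assumes "f y 0 = 0"
  shows "cw_ev2 k t l m (nest_mu_lambda f y q) = poly (map_poly (\<lambda>c. cw_ev k t m (f y c)) q) l"
  unfolding nest_mu_lambda_def
  by (rule poly_subst_functional) (auto simp: assms)

lemma cw_ev2_nest_sum: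
  assumes "f 0 z = 0"
  shows "cw_ev2 k t l m (nest_sum f q z) = poly (map_poly (\<lambda>c. cw_ev k t (l + m) (f c z)) q) l"
  unfolding nest_sum_def
proof (rule poly_subst_functional)
  show "cw_ev2 k t l m (poly_subst (\<lambda>r. [:[:r:]:]) (\<lambda>w. map_poly (pCons 0) w + pCons 0 w) (f c z)) =
      cw_ev k t (l + m) (f c z)" for c
    unfolding cw_ev_def[of k t "l + m"]
    by (rule poly_subst_functional) (auto simp: algebra_simps)
qed (auto simp: assms)

lemma poly_poly_map_poly_const:
  "poly (poly (poly (map_poly (\<lambda>c. [:[:c:]:]) f) p) a) t = poly f (poly (poly p a) t)"
  for f :: "complex poly"
  by (induction f) (auto simp: map_poly_pCons)

lemma cw_coeff_eval:
  "poly (poly (cw_coeff f g) [:l:]) t = poly f (- l) * poly g (t + l) * (t + 2 * l)"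
  by (simp add: cw_coeff_def poly_poly_map_poly_const algebra_simps)

lemma cw_ev_bracket:
  "cw_ev k t l (cw_bracket u v) =
    (\<Sum>i\<in>Poly_Mapping.keys u. poly (Poly_Mapping.lookup u i) (- l) *
      poly (Poly_Mapping.lookup v (k - i)) (t + l) * (t + 2 * l))"
proof -
  have "cw_ev k t l (cw_bracket u v) =
    (\<Sum>i\<in>Poly_Mapping.keys u. \<Sum>j\<in>Poly_Mapping.keys v. if k - i = j then
       poly (Poly_Mapping.lookup u i) (- l) * poly (Poly_Mapping.lookup v j) (t + l) * (t + 2 * l)
     else 0)"
    unfolding cw_bracket_def cw_ev_sum cw_ev_single cw_coeff_eval
    by (intro sum.cong) auto
  also have "\<dots> = (\<Sum>i\<in>Poly_Mapping.keys u. poly (Poly_Mapping.lookup u i) (- l) *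
      poly (Poly_Mapping.lookup v (k - i)) (t + l) * (t + 2 * l))"
    by (intro sum.cong refl) (auto simp: sum.delta' in_keys_iff)
  finally show ?thesis .
qed

lemma sum_keys_flip:
  fixes u v :: cw
  shows "(\<Sum>i\<in>Poly_Mapping.keys u. poly (Poly_Mapping.lookup u i) a *
      poly (Poly_Mapping.lookup v (k - i)) b) =
    (\<Sum>j\<in>Poly_Mapping.keys v. poly (Poly_Mapping.lookup u (k - j)) a *
      poly (Poly_Mapping.lookup v j) b)" (is "?lhs = ?rhs")
proof -
  let ?A = "{i \<in> Poly_Mapping.keys u. k - i \<in> Poly_Mapping.keys v}"
  let ?B = "{j \<in> Poly_Mapping.keys v. k - j \<in> Poly_Mapping.keys u}"
  have "?lhs = (\<Sum>i\<in>?A. poly (Poly_Mapping.lookup u i) a * poly (Poly_Mapping.lookup v (k - i)) b)"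
    by (intro sum.mono_neutral_right) (auto simp: in_keys_iff)
  also have "\<dots> = (\<Sum>j\<in>?B. poly (Poly_Mapping.lookup u (k - j)) a * poly (Poly_Mapping.lookup v j) b)"
    by (rule sum.reindex_bij_witness[of _ "\<lambda>j. k - j" "\<lambda>i. k - i"]) auto
  also have "\<dots> = ?rhs"
    by (intro sum.mono_neutral_left) (auto simp: in_keys_iff)
  finally show ?thesis .
qed

lemma cw_ev_bracket':
  "cw_ev k t l (cw_bracket u v) =
    (\<Sum>j\<in>Poly_Mapping.keys v. poly (Poly_Mapping.lookup u (k - j)) (- l) *
      poly (Poly_Mapping.lookup v j) (t + l) * (t + 2 * l))"
  unfolding cw_ev_bracket sum_distrib_right[symmetric] sum_keys_flip ..

lemma poly_map_poly_sum:
  fixes g :: "'i \<Rightarrow> 'a::zero \<Rightarrow> complex"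
  assumes "finite A" "\<And>i. i \<in> A \<Longrightarrow> g i 0 = 0"
  shows "poly (map_poly (\<lambda>d. \<Sum>i\<in>A. g i d) q) m = (\<Sum>i\<in>A. poly (map_poly (g i) q) m)"
  using assms(2)
proof (induction q)
  case (pCons d q)
  then show ?case
    by (simp add: map_poly_pCons sum.distrib sum_distrib_left)
qed simp

lemma poly_map_poly_cw_ev:
  "poly (map_poly (\<lambda>d. c * poly (Poly_Mapping.lookup d k) t) q) l = c * cw_ev k t l q"
  by (induction q) (auto simp: map_poly_pCons algebra_simps)

lemma cw_bracket_zero [simp]: "cw_bracket 0 v = 0" "cw_bracket u 0 = 0"
  by (simp_all add: cw_bracket_def)

lemma cw_ev_jacobi_1:
  "cw_ev2 k t l m (nest_lambda_mu cw_bracket x (cw_bracket y z)) =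
    (\<Sum>i\<in>Poly_Mapping.keys x. \<Sum>j\<in>Poly_Mapping.keys z.
      poly (Poly_Mapping.lookup x i) (- l) * poly (Poly_Mapping.lookup y (k - i - j)) (- m) *
      poly (Poly_Mapping.lookup z j) (t + l + m) * ((t + l + 2 * m) * (t + 2 * l)))"
proof -
  have "cw_ev2 k t l m (nest_lambda_mu cw_bracket x (cw_bracket y z)) =
      poly (map_poly (\<lambda>d. \<Sum>i\<in>Poly_Mapping.keys x. (poly (Poly_Mapping.lookup x i) (- l) * (t + 2 * l)) *
        poly (Poly_Mapping.lookup d (k - i)) (t + l)) (cw_bracket y z)) m"
    by (simp add: cw_ev2_nest_lambda_mu cw_ev_bracket mult_ac)
  also have "\<dots> = (\<Sum>i\<in>Poly_Mapping.keys x. (poly (Poly_Mapping.lookup x i) (- l) * (t + 2 * l)) *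
        cw_ev (k - i) (t + l) m (cw_bracket y z))"
    by (subst poly_map_poly_sum) (auto simp: poly_map_poly_cw_ev)
  also have "\<dots> = (\<Sum>i\<in>Poly_Mapping.keys x. \<Sum>j\<in>Poly_Mapping.keys z.
      poly (Poly_Mapping.lookup x i) (- l) * poly (Poly_Mapping.lookup y (k - i - j)) (- m) *
      poly (Poly_Mapping.lookup z j) (t + l + m) * ((t + l + 2 * m) * (t + 2 * l)))"
    unfolding cw_ev_bracket' sum_distrib_left by (intro sum.cong refl) (simp add: mult_ac)
  finally show ?thesis .
qed

lemma cw_ev_jacobi_2:
  "cw_ev2 k t l m (nest_sum cw_bracket (cw_bracket x y) z) =
    (\<Sum>i\<in>Poly_Mapping.keys x. \<Sum>j\<in>Poly_Mapping.keys z.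
      poly (Poly_Mapping.lookup x i) (- l) * poly (Poly_Mapping.lookup y (k - i - j)) (- m) *
      poly (Poly_Mapping.lookup z j) (t + l + m) * ((l - m) * (t + 2 * l + 2 * m)))"
proof -
  have "cw_ev2 k t l m (nest_sum cw_bracket (cw_bracket x y) z) =
      poly (map_poly (\<lambda>d. \<Sum>j\<in>Poly_Mapping.keys z.
        (poly (Poly_Mapping.lookup z j) (t + l + m) * (t + 2 * l + 2 * m)) *
        poly (Poly_Mapping.lookup d (k - j)) (- l - m)) (cw_bracket x y)) l"
    by (simp add: cw_ev2_nest_sum cw_ev_bracket' algebra_simps)
  also have "\<dots> = (\<Sum>j\<in>Poly_Mapping.keys z.
        (poly (Poly_Mapping.lookup z j) (t + l + m) * (t + 2 * l + 2 * m)) *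
        cw_ev (k - j) (- l - m) l (cw_bracket x y))"
    by (subst poly_map_poly_sum) (auto simp: poly_map_poly_cw_ev)
  also have "\<dots> = (\<Sum>j\<in>Poly_Mapping.keys z. \<Sum>i\<in>Poly_Mapping.keys x.
      poly (Poly_Mapping.lookup x i) (- l) * poly (Poly_Mapping.lookup y (k - i - j)) (- m) *
      poly (Poly_Mapping.lookup z j) (t + l + m) * ((l - m) * (t + 2 * l + 2 * m)))"
    unfolding cw_ev_bracket sum_distrib_left
    by (intro sum.cong refl) (simp add: mult_ac diff_diff_eq add.commute)
  also have "\<dots> = (\<Sum>i\<in>Poly_Mapping.keys x. \<Sum>j\<in>Poly_Mapping.keys z.
      poly (Poly_Mapping.lookup x i) (- l) * poly (Poly_Mapping.lookup y (k - i - j)) (- m) *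
      poly (Poly_Mapping.lookup z j) (t + l + m) * ((l - m) * (t + 2 * l + 2 * m)))"
    by (rule sum.swap)
  finally show ?thesis .
qed

lemma cw_ev_jacobi_3:
  "cw_ev2 k t l m (nest_mu_lambda cw_bracket y (cw_bracket x z)) =
    (\<Sum>i\<in>Poly_Mapping.keys x. \<Sum>j\<in>Poly_Mapping.keys z.
      poly (Poly_Mapping.lookup x i) (- l) * poly (Poly_Mapping.lookup y (k - i - j)) (- m) *
      poly (Poly_Mapping.lookup z j) (t + l + m) * ((t + m + 2 * l) * (t + 2 * m)))"
proof -
  have "cw_ev2 k t l m (nest_mu_lambda cw_bracket y (cw_bracket x z)) =
      poly (map_poly (\<lambda>d. \<Sum>i\<in>Poly_Mapping.keys y. (poly (Poly_Mapping.lookup y i) (- m) * (t + 2 * m)) *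
        poly (Poly_Mapping.lookup d (k - i)) (t + m)) (cw_bracket x z)) l"
    by (simp add: cw_ev2_nest_mu_lambda cw_ev_bracket mult_ac)
  also have "\<dots> = (\<Sum>i\<in>Poly_Mapping.keys y. (poly (Poly_Mapping.lookup y i) (- m) * (t + 2 * m)) *
        cw_ev (k - i) (t + m) l (cw_bracket x z))"
    by (subst poly_map_poly_sum) (auto simp: poly_map_poly_cw_ev)
  also have "\<dots> = (\<Sum>i\<in>Poly_Mapping.keys y. \<Sum>j\<in>Poly_Mapping.keys z.
      (poly (Poly_Mapping.lookup y i) (- m) * poly (Poly_Mapping.lookup x (k - j - i)) (- l)) *
      (poly (Poly_Mapping.lookup z j) (t + l + m) * ((t + m + 2 * l) * (t + 2 * m))))"
    unfolding cw_ev_bracket' sum_distrib_left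
    by (intro sum.cong refl) (simp add: mult_ac diff_diff_eq add_ac)
  also have "\<dots> = (\<Sum>j\<in>Poly_Mapping.keys z.
      (\<Sum>i\<in>Poly_Mapping.keys y. poly (Poly_Mapping.lookup y i) (- m) *
        poly (Poly_Mapping.lookup x (k - j - i)) (- l)) *
      (poly (Poly_Mapping.lookup z j) (t + l + m) * ((t + m + 2 * l) * (t + 2 * m))))"
    by (subst sum.swap) (simp add: sum_distrib_right)
  also have "\<dots> = (\<Sum>j\<in>Poly_Mapping.keys z. \<Sum>i\<in>Poly_Mapping.keys x.
      poly (Poly_Mapping.lookup x i) (- l) * poly (Poly_Mapping.lookup y (k - i - j)) (- m) *
      poly (Poly_Mapping.lookup z j) (t + l + m) * ((t + m + 2 * l) * (t + 2 * m)))"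
    unfolding sum_keys_flip sum_distrib_right
    by (intro sum.cong refl) (simp add: mult_ac diff_diff_eq add.commute)
  also have "\<dots> = (\<Sum>i\<in>Poly_Mapping.keys x. \<Sum>j\<in>Poly_Mapping.keys z.
      poly (Poly_Mapping.lookup x i) (- l) * poly (Poly_Mapping.lookup y (k - i - j)) (- m) *
      poly (Poly_Mapping.lookup z j) (t + l + m) * ((t + m + 2 * l) * (t + 2 * m)))"
    by (rule sum.swap)
  finally show ?thesis .
qed

lemma cw_bracket_linear_left:
  "Vector_Spaces.linear cw.cscale (\<lambda>c. map_poly (cw.cscale c)) (\<lambda>x. cw_bracket x y)"
  unfolding Vector_Spaces.linear_iff
  by (intro conjI allI cw.vector_space_cscale cw.vector_space_map_poly_cscale; rule cw_ev_eqI)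
    (simp_all add: cw_ev_bracket' lookup_add lookup_cw_cscale sum.distrib sum_distrib_left algebra_simps)

lemma cw_bracket_linear_right:
  "Vector_Spaces.linear cw.cscale (\<lambda>c. map_poly (cw.cscale c)) (\<lambda>y. cw_bracket x y)"
  unfolding Vector_Spaces.linear_iff
  by (intro conjI allI cw.vector_space_cscale cw.vector_space_map_poly_cscale; rule cw_ev_eqI)
    (simp_all add: cw_ev_bracket lookup_add lookup_cw_cscale sum.distrib sum_distrib_left algebra_simps)

theorem lie_conformal_algebra_cw: "lie_conformal_algebra cw_scale cw_bracket"
proof unfold_locales
  fix x y z :: cw
  show "cw.bilinear_lambda cw_bracket"
    by (simp add: cw.bilinear_lambda_def cw_bracket_linear_left cw_bracket_linear_right)
  show "cw_bracket (cw.del x) y = - pCons 0 (cw_bracket x y)"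
    by (rule cw_ev_eqI)
      (simp add: cw_ev_bracket' cw.del_def sum_distrib_left sum_negf mult_ac)
  show "cw_bracket x y = - cw.subst_neg (cw_bracket y x)"
  proof (rule cw_ev_eqI)
    fix k t l
    have "cw_ev k t l (- cw.subst_neg (cw_bracket y x)) =
        - (\<Sum>j\<in>Poly_Mapping.keys x. poly (Poly_Mapping.lookup y (k - j)) (t + l) *
          poly (Poly_Mapping.lookup x j) (- l) * (- t - 2 * l))"
      by (simp add: cw_ev_subst_neg cw_ev_bracket' algebra_simps)
    also have "\<dots> = cw_ev k t l (cw_bracket x y)"
      unfolding cw_ev_bracket sum_negf[symmetric]
      by (intro sum.cong refl) (simp add: algebra_simps)
    finally show "cw_ev k t l (cw_bracket x y) = cw_ev k t l (- cw.subst_neg (cw_bracket y x))" ..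
  qed
  show "nest_lambda_mu cw_bracket x (cw_bracket y z) =
      nest_sum cw_bracket (cw_bracket x y) z + nest_mu_lambda cw_bracket y (cw_bracket x z)"
  proof (rule cw_ev2_eqI)
    fix k :: int and t l m :: complex
    have "(t + l + 2 * m) * (t + 2 * l) =
        (l - m) * (t + 2 * l + 2 * m) + (t + m + 2 * l) * (t + 2 * m)"
      by (simp add: algebra_simps)
    then show "cw_ev2 k t l m (nest_lambda_mu cw_bracket x (cw_bracket y z)) =
        cw_ev2 k t l m (nest_sum cw_bracket (cw_bracket x y) z +
          nest_mu_lambda cw_bracket y (cw_bracket x z))"
      unfolding cw_ev2_add cw_ev_jacobi_1 cw_ev_jacobi_2 cw_ev_jacobi_3 sum.distrib[symmetric]
        distrib_left[symmetric] by simp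
  qed
qed

global_interpretation cw: lie_conformal_algebra cw_scale cw_bracket
  by (rule lie_conformal_algebra_cw)

theorem cw_bracket_L: "cw_bracket (L i) (L j) = del_plus_2lambda (L (i + j))"
  by (rule cw_ev_eqI)
    (auto simp: cw_ev_bracket del_plus_2lambda_def L_def lookup_single when_def)

end

theory Submission
  imports Defs
begin

text \<open>
  Let \<open>F i j k t l\<close> be the \<open>L k\<close>-component of \<open>\<phi>\<^sub>\<lambda>(L i, L j)\<close> at \<open>\<partial> = t\<close>, \<open>\<lambda> = l\<close>.
  On generators the two axioms of a biderivation become functional equations between complex
  numbers: the derivation rule is
  \[ (t + l + 2m) F_{i,j+p}^k(t,l)
       = (t + 2l + 2m) F_{i,j}^{k-p}(-l-m,l) + (t + 2m) F_{i,p}^{k-j}(t+m,l) \]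
  (\<open>generators_derivation\<close>), and skew symmetry is \<open>F i j k t l = - F j i k t (- t - l)\<close>
  (\<open>generators_skew\<close>).

  For \<open>j = 0\<close>, \<open>m = 0\<close> the unknown on the left side of the derivation rule cancels against
  the last term up to the factor \<open>l\<close>. What remains says that, for
  \<open>l \<noteq> 0\<close>, \<open>F i p k t l\<close> is \<open>t + 2 * l\<close> times a number \<open>C i (k - p) l\<close> in which \<open>t\<close> does
  not occur (\<open>generators_factor\<close>). Skew symmetry exchanges \<open>l\<close> with \<open>- t - l\<close>, and here
  \<open>t\<close> is arbitrary; so \<open>C\<close> does not depend on \<open>l\<close> either, and it is symmetric under the
  exchange of \<open>i\<close> and \<open>j\<close>, which leaves a function of \<open>k - i - j\<close> alone
  (\<open>factor_constant\<close>). The values at \<open>l = 0\<close> are recovered from skew symmetry and one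
  further use of the derivation rule (\<open>generators_eq\<close>). The resulting family \<open>a\<close> has
  finite support because \<open>a k\<close> is read off from the \<open>L k\<close>-component of the single element
  \<open>\<phi>\<^sub>\<lambda>(L 0, L 0)\<close>.
\<close>

lemma finite_cw_ev_support: "finite {k. cw_ev k t l p \<noteq> 0}"
proof (induction p)
  case (pCons r p)
  have "{k. cw_ev k t l (pCons r p) \<noteq> 0} \<subseteq> Poly_Mapping.keys r \<union> {k. cw_ev k t l p \<noteq> 0}"
    by (auto simp: in_keys_iff)
  then show ?case
    using pCons by (meson finite_UnI finite_keys finite_subset)
qed simp

lemma cw_ev_del_plus_2lambda:
  "cw_ev k t l (del_plus_2lambda v) = (t + 2 * l) * poly (Poly_Mapping.lookup v k) t"
proof -
  have two: "poly 2 t = (2 :: complex)"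
    by (metis poly_numeral)
  show ?thesis
    by (simp add: del_plus_2lambda_def two algebra_simps)
qed

lemma cw_ev_bracket_L_left:
  "cw_ev k t l (cw_bracket (L i) v) =
    (t + 2 * l) * poly (Poly_Mapping.lookup v (k - i)) (t + l)"
  by (simp add: cw_ev_bracket L_def mult_ac)

lemma cw_ev_bracket_L_right:
  "cw_ev k t l (cw_bracket u (L j)) =
    (t + 2 * l) * poly (Poly_Mapping.lookup u (k - j)) (- l)"
  by (simp add: cw_ev_bracket' L_def mult_ac)

lemma lookup_sum_L:
  assumes "finite {k. b k \<noteq> 0}"
  shows "Poly_Mapping.lookup (\<Sum>k | b k \<noteq> 0. cw_scale [:b k:] (L k)) n = [:b n:]"
proof -
  have "Poly_Mapping.lookup (\<Sum>k | b k \<noteq> 0. cw_scale [:b k:] (L k)) n =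
      (\<Sum>k | b k \<noteq> 0. if k = n then [:b k:] else 0)"
    by (simp add: lookup_sum L_def lookup_single when_def if_distrib cong: if_cong)
  also have "\<dots> = [:b n:]"
    using assms by (simp add: sum.delta)
  finally show ?thesis .
qed

locale cw_biderivation = conformal_biderivation cw_scale cw_bracket \<phi>
  for \<phi> :: "cw \<Rightarrow> cw \<Rightarrow> cw poly"
begin

definition F :: "int \<Rightarrow> int \<Rightarrow> int \<Rightarrow> complex \<Rightarrow> complex \<Rightarrow> complex"
  where "F i j k t l = cw_ev k t l (\<phi> (L i) (L j))"

lemma linear_right: "Vector_Spaces.linear cw.cscale (\<lambda>c. map_poly (cw.cscale c)) (\<lambda>y. \<phi> x y)"
  using bilinear unfolding cw.bilinear_lambda_def by blast

lemma phi_zero_right: "\<phi> x 0 = 0"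
  using linear_right[of x] unfolding Vector_Spaces.linear_iff
  by (metis add_cancel_right_right)

lemma phi_cscale_right: "\<phi> x (cw.cscale c y) = map_poly (cw.cscale c) (\<phi> x y)"
  using linear_right[of x] unfolding Vector_Spaces.linear_iff by blast

lemma generators_skew: "F i j k t l = - F j i k t (- t - l)"
  unfolding F_def by (subst skew) (simp add: cw_ev_subst_neg)

lemma generators_derivation:
  "(t + l + 2 * m) * F i (j + p) k t l =
    (t + 2 * l + 2 * m) * F i j (k - p) (- l - m) l + (t + 2 * m) * F i p (k - j) (t + m) l"
proof -
  have bracket: "cw_bracket (L j) (L p) = [:cw.del (L (j + p)), cw.cscale 2 (L (j + p)):]"
    by (simp add: cw_bracket_L del_plus_2lambda_def cw.del_def cw.cscale_def numeral_poly)
  have "cw_ev2 k t l m (nest_lambda_mu \<phi> (L i) (cw_bracket (L j) (L p))) =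
      (t + l + 2 * m) * F i (j + p) k t l"
    by (simp add: cw_ev2_nest_lambda_mu phi_zero_right bracket map_poly_pCons del_right
        phi_cscale_right F_def algebra_simps)
  moreover have "cw_ev2 k t l m (nest_sum cw_bracket (\<phi> (L i) (L j)) (L p)) =
      (t + 2 * l + 2 * m) * F i j (k - p) (- l - m) l"
    by (simp add: cw_ev2_nest_sum cw_ev_bracket_L_right poly_map_poly_cw_ev F_def add.assoc)
  moreover have "cw_ev2 k t l m (nest_mu_lambda cw_bracket (L j) (\<phi> (L i) (L p))) =
      (t + 2 * m) * F i p (k - j) (t + m) l"
    by (simp add: cw_ev2_nest_mu_lambda cw_ev_bracket_L_left poly_map_poly_cw_ev F_def)
  ultimately show ?thesis
    using arg_cong[OF derivation[of "L i" "L j" "L p"], of "cw_ev2 k t l m"] by simp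
qed

definition C :: "int \<Rightarrow> int \<Rightarrow> complex \<Rightarrow> complex"
  where "C i k l = F i 0 k (- l) l / l"

text \<open>
  With \<open>L 0\<close> as second argument and \<open>m = 0\<close>, the derivation rule contains the same value of
  \<open>F\<close> on both sides, with factors \<open>t + l\<close> and \<open>t\<close>; the third term is taken at
  \<open>\<partial> = - l\<close> and so does not involve \<open>t\<close> beyond its factor \<open>t + 2 * l\<close>.
\<close>

lemma generators_factor:
  assumes "l \<noteq> 0"
  shows "F i j k t l = (t + 2 * l) * C i (k - j) l"
proof -
  have "(t + l) * F i j k t l = (t + 2 * l) * F i 0 (k - j) (- l) l + t * F i j k t l"
    using generators_derivation[of t l 0 i 0 j k] by simp
  then have "l * F i j k t l = (t + 2 * l) * F i 0 (k - j) (- l) l"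
    by (simp add: algebra_simps)
  then show ?thesis
    using assms by (simp add: C_def field_simps)
qed

text \<open>Skew symmetry at the point \<open>t = - l - l'\<close>, where \<open>t + 2 * l = l - l'\<close> can be cancelled.\<close>

lemma factor_skew:
  assumes "l \<noteq> 0" "l' \<noteq> 0" "l \<noteq> l'"
  shows "C i (k - j) l = C j (k - i) l'"
proof -
  have "F i j k (- l - l') l = - F j i k (- l - l') l'"
    using generators_skew[of i j k "- l - l'" l] by simp
  then have "(l - l') * C i (k - j) l = (l - l') * C j (k - i) l'"
    using assms by (simp add: generators_factor algebra_simps)
  then show ?thesis
    using assms by simp
qed

definition a :: "int \<Rightarrow> complex"
  where "a k = C 0 k 1"

text \<open>
  \<open>factor_skew\<close> only relates different arguments and \<open>l = 1\<close> is possible, so the step from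
  \<open>l\<close> to \<open>1\<close> passes through the auxiliary argument \<open>2 * l\<close>.
\<close>

lemma factor_constant:
  assumes "l \<noteq> 0"
  shows "C i k l = a (k - i)"
proof -
  have "C i k l = C 0 (k - i) (2 * l)"
    using factor_skew[of l "2 * l" i k 0] assms by simp
  also have "\<dots> = a (k - i)"
    using factor_skew[of "2 * l" 1 0 "k - i" 0] assms by (cases "2 * l = 1") (auto simp: a_def)
  finally show ?thesis .
qed

lemma generators_eq: "F i j k t l = (t + 2 * l) * a (k - i - j)"
proof -
  have nonzero: "F i j k t l = (t + 2 * l) * a (k - i - j)" if "l \<noteq> 0" for i j k t l
    using that by (simp add: generators_factor factor_constant algebra_simps)
  have zero: "F i j k t 0 = t * a (k - i - j)" if "t \<noteq> 0" for i j k t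
    using nonzero[of "- t" j i k t] generators_skew[of i j k t 0] that
    by (simp add: algebra_simps)
  \<comment> \<open>At \<open>t = l = 0\<close> the derivation rule with \<open>m = 1\<close> expresses the value as a sum of
    the values at \<open>t = - 1\<close> and \<open>t = 1\<close>, which cancel.\<close>
  have origin: "F i j k 0 0 = 0"
    using generators_derivation[of 0 0 1 i 0 j k] zero[of "- 1" i 0 "k - j"] zero[of 1 i j k]
    by (simp add: algebra_simps)
  show ?thesis
    using nonzero zero origin by (cases "l = 0"; cases "t = 0") auto
qed

lemma finite_support_a: "finite {k. a k \<noteq> 0}"
  using finite_cw_ev_support[of "- 1" 1 "\<phi> (L 0) (L 0)"] by (simp add: a_def C_def F_def)

end

theorem theorem3p1:
  fixes \<phi> :: "cw \<Rightarrow> cw \<Rightarrow> cw poly"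
  assumes "conformal_biderivation cw_scale cw_bracket \<phi>"
  shows "\<exists>a :: int \<Rightarrow> complex. finite {k. a k \<noteq> 0} \<and>
    (\<forall>i j. \<phi> (L i) (L j) =
      del_plus_2lambda (\<Sum>k | a (k - i - j) \<noteq> 0. cw_scale [:a (k - i - j):] (L k)))"
proof -
  interpret cw_biderivation \<phi>
    using assms by (simp add: cw_biderivation_def)
  have "\<phi> (L i) (L j) =
      del_plus_2lambda (\<Sum>k | a (k - i - j) \<noteq> 0. cw_scale [:a (k - i - j):] (L k))" for i j
  proof (rule cw_ev_eqI)
    fix n t l
    have "finite ((\<lambda>k. k - i - j) -` {k. a k \<noteq> 0})"
      by (rule finite_vimageI[OF finite_support_a]) (auto intro: injI)
    then have "finite {k. a (k - i - j) \<noteq> 0}"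
      by (simp add: vimage_def)
    then show "cw_ev n t l (\<phi> (L i) (L j)) = cw_ev n t l
        (del_plus_2lambda (\<Sum>k | a (k - i - j) \<noteq> 0. cw_scale [:a (k - i - j):] (L k)))"
      using generators_eq[of i j n t l] by (simp add: cw_ev_del_plus_2lambda lookup_sum_L F_def)
  qed
  with finite_support_a show ?thesis
    by blast
qed

end
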